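(* Let $M\in\mathbb{R}^{n\times n}$ be symmetric positive semidefinite and $F(P)=\|M-MP\|_F^2$. Let $\mathcal{P}_{\mathrm{all}}$ be the set of all rank-$k$ orthogonal projectors in $\mathbb{R}^{n\times n}$, $\mathcal{P}_{\mathrm{fuzzy}}$ the set of projectors $P_B$ induced by fuzzy $c$-means type matrices $B$, and $\mathcal{P}_{\mathrm{hard}}$ the set of projectors $P_H$ induced by hard assignment matrices $H$. Assume that $\mathcal{P}_{\mathrm{hard}}\neq\emptyset$ and $\mathcal{P}_{\mathrm{fuzzy}}\neq\emptyset$. Then $$\min_{P\in\mathcal{P}_{\mathrm{all}}}F(P)\;\le\;\min_{P\in\mathcal{P}_{\mathrm{fuzzy}}}F(P)\;\le\;\min_{P\in\mathcal{P}_{\mathrm{hard}}}F(P).$$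
   Context: $\|\cdot\|_F$ is the Frobenius norm. For $B\in\mathbb{R}^{k\times n}$ of full row rank $k$, $P_B=B^\top(BB^\top)^{-1}B$. A hard assignment matrix is $H\in\{0,1\}^{k\times n}$ each of whose columns has exactly one entry equal to $1$, with no zero row (no empty cluster). $\mathcal{P}_{\mathrm{hard}}$ is the set of all such $P_H$. A fuzzy membership matrix is $U=[u_{ji}]\in[0,1]^{k\times n}$ with $\sum_{j=1}^ku_{ji}=1$ for every $i=1,\dots,n$. With a fixed fuzzifier $m>1$, the fuzzy $c$-means type matrix associated with $U$ is $B(U)\in\mathbb{R}^{k\times n}$, $B_{ji}(U)=u_{ji}^m\big/\sum_{\ell=1}^nu_{j\ell}^m$. $\mathcal{P}_{\mathrm{fuzzy}}$ is the set of all $P_{B(U)}$ for which $B(U)$ is defined and has full row rank $k$.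
   Formalization: The minimum over the fuzzy projectors need not be attained (e.g. n=3, k=2, M the projector onto the plane x1+x2=2x3), so it is stated as an infimum; the minima over all rank-k projectors and over hard projectors are proved to be attained. *)

theory Defs
  imports "HOL-Analysis.Analysis"
begin

text \<open>
  A $k \times n$ matrix is an element of \<open>real^'n^'k\<close>, so that \<open>A $ j\<close> is the \<open>j\<close>-th row, and
  $k$, $n$ are \<open>CARD('k)\<close>, \<open>CARD('n)\<close>. The library norm on this type is the Frobenius norm:
\<close>

lemma norm_matrix_eq_frobenius:
  fixes A :: "real^'n^'m"
  shows "norm A = sqrt (\<Sum>i\<in>UNIV. \<Sum>j\<in>UNIV. (A $ i $ j)\<^sup>2)"
  by (simp add: norm_vec_def L2_set_def sum_nonneg)

definition sym_psd :: "real^'n^'n \<Rightarrow> bool" where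
  "sym_psd M \<longleftrightarrow> transpose M = M \<and> (\<forall>x. 0 \<le> x \<bullet> (M *v x))"

definition proj_loss :: "real^'n^'n \<Rightarrow> real^'n^'n \<Rightarrow> real" where
  "proj_loss M P = (norm (M - M ** P))\<^sup>2"

definition orth_projectors :: "nat \<Rightarrow> (real^'n^'n) set" where
  "orth_projectors k = {P. P ** P = P \<and> transpose P = P \<and> rank P = k}"

text \<open>Meaningful only if \<open>B\<close> has full row rank, so that $B B^T$ is invertible.\<close>

definition row_projector :: "real^'n^'k \<Rightarrow> real^'n^'n" where
  "row_projector B = transpose B ** matrix_inv (B ** transpose B) ** B"

definition hard_assignment :: "real^'n^'k \<Rightarrow> bool" where
  "hard_assignment H \<longleftrightarrow>
     (\<forall>j i. H $ j $ i \<in> {0, 1}) \<and> (\<forall>i. \<exists>!j. H $ j $ i = 1) \<and> (\<forall>j. H $ j \<noteq> 0)"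

definition fuzzy_membership :: "real^'n^'k \<Rightarrow> bool" where
  "fuzzy_membership U \<longleftrightarrow>
     (\<forall>j i. U $ j $ i \<in> {0..1}) \<and> (\<forall>i. (\<Sum>j\<in>UNIV. U $ j $ i) = 1)"

definition fcm_matrix :: "real \<Rightarrow> real^'n^'k \<Rightarrow> real^'n^'k" where
  "fcm_matrix m U = (\<chi> j i. U $ j $ i powr m / (\<Sum>l\<in>UNIV. U $ j $ l powr m))"

text \<open>
  The argument of type \<open>'k itself\<close> only carries the number $k$ of clusters, which the type of an
  $n \times n$ projector does not show. In the second set, the condition on the sums says that the
  fuzzy $c$-means type matrix is defined (no zero denominator).
\<close>

definition hard_projectors :: "'k::finite itself \<Rightarrow> (real^'n^'n) set" where
  "hard_projectors T = {row_projector H | H :: real^'n^'k. hard_assignment H}"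

definition fuzzy_projectors :: "'k::finite itself \<Rightarrow> real \<Rightarrow> (real^'n^'n) set" where
  "fuzzy_projectors T m =
     {row_projector (fcm_matrix m U) | U :: real^'n^'k.
        fuzzy_membership U \<and>
        (\<forall>j. (\<Sum>l\<in>UNIV. U $ j $ l powr m) \<noteq> 0) \<and>
        rank (fcm_matrix m U) = CARD('k)}"

end

theory Submission
  imports Defs
begin

text \<open>
  Both inequalities are inclusions of feasible sets. A matrix \<open>B\<close> of full row rank induces a rank-$k$
  orthogonal projector, so the fuzzy projectors are orthogonal projectors. The fuzzy $c$-means type
  matrix of a hard assignment matrix \<open>H\<close> only rescales the rows of \<open>H\<close>, and \<open>row_projector\<close> depends
  only on the row space, so the hard projectors are fuzzy projectors. The first minimum exists
  because the rank-$k$ orthogonal projectors are the image of the compact Stiefel manifold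
  $\{V \mid V V^T = I\}$ under $V \mapsto V^T V$, the last one because there are finitely many hard
  assignments.
\<close>

section \<open>Matrix inverses and the projector onto a row space\<close>

lemma matrix_inv_right_left:
  fixes A :: "real^'n^'m"
  assumes "invertible A"
  shows "A ** matrix_inv A = mat 1" and "matrix_inv A ** A = mat 1"
proof -
  have "A ** matrix_inv A = mat 1 \<and> matrix_inv A ** A = mat 1"
    using assms unfolding invertible_def matrix_inv_def by (rule someI_ex)
  then show "A ** matrix_inv A = mat 1" "matrix_inv A ** A = mat 1" by auto
qed

text \<open>A one-sided inverse of a square matrix is two-sided, and two-sided inverses are unique,
  so the choice in \<open>matrix_inv\<close> is forced.\<close>

lemma matrix_inv_eqI:
  fixes A :: "real^'n^'n"
  assumes "A ** B = mat 1"
  shows "matrix_inv A = B"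
proof -
  have BA: "B ** A = mat 1" using assms matrix_left_right_inverse by blast
  then have "invertible A" using assms by (auto simp: invertible_def)
  then show ?thesis
    by (metis BA matrix_inv_right_left(1) matrix_mul_assoc matrix_mul_lid matrix_mul_rid)
qed

lemma transpose_matrix_inv:
  fixes A :: "real^'n^'n"
  assumes "invertible A"
  shows "matrix_inv (transpose A) = transpose (matrix_inv A)"
proof (rule matrix_inv_eqI)
  have "transpose A ** transpose (matrix_inv A) = transpose (matrix_inv A ** A)"
    by (simp only: matrix_transpose_mul)
  also have "\<dots> = mat 1"
    by (simp only: matrix_inv_right_left(2)[OF assms] transpose_mat)
  finally show "transpose A ** transpose (matrix_inv A) = mat 1" .
qed

text \<open>The quadratic form of the Gram matrix at \<open>x\<close> is the squared norm of
  \<open>transpose B *v x\<close>, so both matrices have the same kernel; it is trivial because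
  \<open>transpose B\<close> has full column rank.\<close>

lemma invertible_gram_of_full_row_rank:
  fixes B :: "real^'n^'k"
  assumes "rank B = CARD('k)"
  shows "invertible (B ** transpose B)"
proof -
  have inj: "inj ((*v) (transpose B))"
    using assms by (simp add: rank_transpose flip: full_rank_injective)
  have "x = 0" if "(B ** transpose B) *v x = 0" for x
  proof -
    have "(transpose B *v x) \<bullet> (transpose B *v x) = x \<bullet> ((B ** transpose B) *v x)"
      by (metis dot_lmul_matrix matrix_vector_mul_assoc transpose_matrix_vector)
    then have "transpose B *v x = transpose B *v 0" using that by simp
    then show ?thesis using inj by (simp only: inj_eq)
  qed
  then have "inj ((*v) (B ** transpose B))"
    by (simp add: linear_injective_0)
  then show ?thesis
    by (simp add: invertible_left_inverse matrix_left_invertible_injective)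
qed

text \<open>Everything but symmetry follows from \<open>B ** P = B\<close>: it gives idempotence,
  and it squeezes \<open>rank P\<close> between \<open>rank B\<close> and itself. Symmetry is
  inherited from the inverse of the Gram matrix.\<close>

lemma row_projector_in_orth_projectors:
  fixes B :: "real^'n^'k"
  assumes "rank B = CARD('k)"
  shows "row_projector B \<in> orth_projectors CARD('k)"
proof -
  let ?G = "B ** transpose B"
  let ?X = "matrix_inv ?G"
  let ?P = "row_projector B"
  have inv: "invertible ?G" by (rule invertible_gram_of_full_row_rank[OF assms])
  have BP: "B ** ?P = B"
    unfolding row_projector_def using matrix_inv_right_left(1)[OF inv]
    by (simp only: matrix_mul_assoc matrix_mul_lid)
  have "?P ** ?P = transpose B ** ?X ** (B ** ?P)"
    by (simp only: row_projector_def matrix_mul_assoc)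
  also have "\<dots> = ?P"
    unfolding BP by (simp only: row_projector_def)
  finally have "?P ** ?P = ?P" .
  moreover have "transpose ?X = ?X"
    using transpose_matrix_inv[OF inv] by (simp add: matrix_transpose_mul)
  then have "transpose ?P = ?P"
    by (simp add: row_projector_def matrix_transpose_mul matrix_mul_assoc)
  moreover have "rank ?P \<le> rank B"
    unfolding row_projector_def by (rule rank_mul_le_right)
  then have "rank ?P = CARD('k)"
    using rank_mul_le_right[of B ?P] BP assms by simp
  ultimately show ?thesis by (simp add: orth_projectors_def)
qed

text \<open>An invertible \<open>D\<close> on the left keeps the row space. In the formula, the Gram
  inverse picks up \<open>?E\<close> and its transpose, which cancel the outer factors
  \<open>D\<close>.\<close>

lemma row_projector_invertible_mult:
  fixes B :: "real^'n^'k"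
  assumes "rank B = CARD('k)" and "invertible D"
  shows "row_projector (D ** B) = row_projector B"
proof -
  let ?X = "matrix_inv (B ** transpose B)"
  let ?E = "matrix_inv D"
  have X: "B ** transpose B ** ?X = mat 1"
    using invertible_gram_of_full_row_rank[OF assms(1)] by (rule matrix_inv_right_left)
  have DE: "D ** ?E = mat 1" and ED: "?E ** D = mat 1"
    using assms(2) by (rule matrix_inv_right_left)+
  have DEt: "transpose D ** transpose ?E = mat 1"
    by (metis ED matrix_transpose_mul transpose_mat)
  have "D ** B ** transpose (D ** B) ** (transpose ?E ** ?X ** ?E)
      = D ** (B ** transpose B ** (transpose D ** transpose ?E) ** ?X) ** ?E"
    by (simp only: matrix_transpose_mul matrix_mul_assoc)
  also have "\<dots> = mat 1" by (simp only: DEt matrix_mul_rid X DE)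
  finally have "matrix_inv (D ** B ** transpose (D ** B)) = transpose ?E ** ?X ** ?E"
    by (rule matrix_inv_eqI)
  then have "row_projector (D ** B)
      = transpose B ** (transpose D ** transpose ?E) ** ?X ** (?E ** D) ** B"
    by (simp only: row_projector_def matrix_transpose_mul matrix_mul_assoc)
  then show ?thesis by (simp only: DEt ED matrix_mul_rid row_projector_def)
qed

lemma rank_invertible_mult:
  fixes B :: "real^'n^'k"
  assumes "invertible D"
  shows "rank (D ** B) = rank B"
  using rank_mul_le_right[of D B] rank_mul_le_right[of "matrix_inv D" "D ** B"]
  by (simp add: matrix_mul_assoc matrix_inv_right_left(2)[OF assms])

section \<open>Hard assignments and their projectors\<close>

lemma hard_assignment_rank:
  fixes H :: "real^'n^'k"
  assumes "hard_assignment H"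
  shows "rank H = CARD('k)"
proof -
  have "x $ j = 0" if x: "transpose H *v x = 0" for x j
  proof -
    \<comment> \<open>Pick a point \<open>i\<close> of the nonempty cluster \<open>j\<close>. Column
      \<open>i\<close> of \<open>H\<close> is then the \<open>j\<close>-th unit vector, so entry
      \<open>i\<close> of \<open>transpose H *v x\<close> is \<open>x $ j\<close>.\<close>
    obtain i where "H $ j $ i \<noteq> 0"
      using assms by (force simp: hard_assignment_def vec_eq_iff)
    then have ji: "H $ j $ i = 1"
      using assms by (auto simp: hard_assignment_def)
    have "\<exists>!l. H $ l $ i = 1" using assms by (simp only: hard_assignment_def)
    then have "H $ l $ i = 1 \<longleftrightarrow> l = j" for l using ji by blast
    moreover have "H $ l $ i \<in> {0, 1}" for l
      using assms by (simp only: hard_assignment_def)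
    ultimately have col: "H $ l $ i = of_bool (l = j)" for l by fastforce
    have "0 = (\<Sum>l\<in>UNIV. H $ l $ i * x $ l)"
      using arg_cong[OF x, of "\<lambda>v. v $ i"]
      by (simp add: matrix_vector_mult_def transpose_def)
    then show ?thesis by (simp add: col)
  qed
  then have "inj ((*v) (transpose H))"
    by (simp add: linear_injective_0 vec_eq_iff)
  then show ?thesis by (simp add: rank_transpose flip: full_rank_injective)
qed

text \<open>\<open>H\<close> itself serves as the membership matrix: \<open>powr m\<close> fixes 0
  and 1, so \<open>fcm_matrix\<close> just divides each row of \<open>H\<close> by its cluster
  size.\<close>

lemma hard_projectors_subset_fuzzy_projectors:
  assumes "m > 1"
  shows "(hard_projectors TYPE('k::finite) :: (real^'n^'n) set) \<subseteq> fuzzy_projectors TYPE('k) m"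
proof
  fix P :: "real^'n^'n"
  assume "P \<in> hard_projectors TYPE('k)"
  then obtain H :: "real^'n^'k" where P: "P = row_projector H" and H: "hard_assignment H"
    by (auto simp: hard_projectors_def)
  have H01: "H $ j $ i = 0 \<or> H $ j $ i = 1" for j i
    using H by (auto simp: hard_assignment_def)
  have powr: "H $ j $ i powr m = H $ j $ i" for j i
    using H01[of j i] by auto
  have "fuzzy_membership H"
    unfolding fuzzy_membership_def
  proof (intro conjI allI)
    show "H $ j $ i \<in> {0..1}" for j i using H01[of j i] by auto
    fix i
    have "\<exists>!j. H $ j $ i = 1" using H by (simp only: hard_assignment_def)
    then obtain c where "H $ j $ i = 1 \<longleftrightarrow> j = c" for j by blast
    then have "H $ j $ i = of_bool (j = c)" for j using H01[of j i] by auto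
    then show "(\<Sum>j\<in>UNIV. H $ j $ i) = 1" by simp
  qed
  moreover have s: "(\<Sum>l\<in>UNIV. H $ j $ l) \<noteq> 0" for j
  proof
    assume "(\<Sum>l\<in>UNIV. H $ j $ l) = 0"
    moreover have "0 \<le> H $ j $ l" for l using H01[of j l] by auto
    ultimately have "H $ j = 0" by (simp add: sum_nonneg_eq_0_iff vec_eq_iff)
    then show False using H by (simp add: hard_assignment_def)
  qed
  moreover
  \<comment> \<open>The diagonal matrix of reciprocal cluster sizes; the diagonal matrix of the
    sizes is its inverse.\<close>
  define D :: "real^'k^'k"
    where "D = (\<chi> a b. if a = b then 1 / (\<Sum>l\<in>UNIV. H $ a $ l) else 0)"
  have "D ** (\<chi> a b. if a = b then (\<Sum>l\<in>UNIV. H $ a $ l) else 0) = mat 1"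
    using s by (simp add: D_def matrix_matrix_mult_def mat_def vec_eq_iff if_distrib[of "\<lambda>x. _ * x"]
      if_distrib[of "\<lambda>x. x * _"] cong: if_cong)
  then have D: "invertible D" by (auto simp: invertible_right_inverse)
  have fcm: "fcm_matrix m H = D ** H"
    by (simp add: D_def fcm_matrix_def powr matrix_matrix_mult_def vec_eq_iff
      if_distrib[of "\<lambda>x. x * _"] cong: if_cong)
  have "rank (fcm_matrix m H) = CARD('k)"
    by (simp add: fcm rank_invertible_mult[OF D] hard_assignment_rank[OF H])
  moreover have "P = row_projector (fcm_matrix m H)"
    by (simp add: fcm P row_projector_invertible_mult[OF hard_assignment_rank[OF H] D])
  ultimately show "P \<in> fuzzy_projectors TYPE('k) m"
    unfolding fuzzy_projectors_def by (auto simp: powr)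
qed

lemma fuzzy_projectors_subset_orth_projectors:
  "(fuzzy_projectors TYPE('k::finite) m :: (real^'n^'n) set) \<subseteq> orth_projectors CARD('k)"
  by (auto simp: fuzzy_projectors_def row_projector_in_orth_projectors)

lemma finite_hard_projectors:
  "finite (hard_projectors TYPE('k::finite) :: (real^'n^'n) set)"
proof -
  \<comment> \<open>A hard assignment is determined by the pattern of its ones, and there are
    finitely many boolean matrices.\<close>
  have "H \<in> range (\<lambda>b :: bool^'n^'k. \<chi> j i. of_bool (b $ j $ i))"
    if "hard_assignment H" for H :: "real^'n^'k"
  proof (rule range_eqI)
    show "H = (\<chi> j i. of_bool ((\<chi> j i. H $ j $ i = 1) $ j $ i))"
      using that by (auto simp: vec_eq_iff hard_assignment_def)
  qed
  then have "finite {H :: real^'n^'k. hard_assignment H}"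
    by (intro finite_subset[OF _ finite_imageI[OF finite]]) blast
  then show ?thesis
    unfolding hard_projectors_def setcompr_eq_image by (rule finite_imageI)
qed

section \<open>Compactness of the set of rank-k orthogonal projectors\<close>

lemma continuous_on_matrix_matrix_mult [continuous_intros]:
  fixes f :: "'a::topological_space \<Rightarrow> real^'n^'m" and g :: "'a \<Rightarrow> real^'p^'n"
  assumes "continuous_on S f" and "continuous_on S g"
  shows "continuous_on S (\<lambda>x. f x ** g x)"
  unfolding matrix_matrix_mult_def using assms by (intro continuous_intros)

lemma continuous_on_transpose [continuous_intros]:
  fixes f :: "'a::topological_space \<Rightarrow> real^'n^'m"
  assumes "continuous_on S f"
  shows "continuous_on S (\<lambda>x. transpose (f x))"
  unfolding transpose_def using assms by (intro continuous_intros)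

text \<open>The rows are unit vectors, so the sum of their norms gives a crude but sufficient bound;
  closedness holds because the defining equation is continuous.\<close>

lemma compact_stiefel: "compact {V :: real^'n^'k. V ** transpose V = mat 1}"
proof -
  have "norm V \<le> CARD('k)" if V: "V ** transpose V = mat 1" for V :: "real^'n^'k"
  proof -
    have "V $ j \<bullet> V $ j = 1" for j
      using arg_cong[OF V, of "\<lambda>A. A $ j $ j"]
      by (simp add: matrix_matrix_mult_def transpose_def inner_vec_def mat_def)
    then have "norm (V $ j) = 1" for j by (simp add: norm_eq_1)
    then show ?thesis
      using L2_set_le_sum[of UNIV "\<lambda>j. norm (V $ j)"] by (simp add: norm_vec_def)
  qed
  then have "bounded {V :: real^'n^'k. V ** transpose V = mat 1}"
    unfolding bounded_iff by blast
  moreover have "closed {V :: real^'n^'k. V ** transpose V = mat 1}"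
    by (intro closed_Collect_eq continuous_intros)
  ultimately show ?thesis by (simp add: compact_eq_bounded_closed)
qed

text \<open>The rows of \<open>V\<close> form an orthonormal basis of the range of \<open>P\<close>.
  This avoids the condition on \<open>rank\<close>, which is not a continuous function of the
  matrix.\<close>

lemma orth_projectors_eq_stiefel_image:
  "(orth_projectors CARD('k::finite) :: (real^'n^'n) set)
    = (\<lambda>V. transpose V ** V) ` {V :: real^'n^'k. V ** transpose V = mat 1}"
proof (intro subset_antisym subsetI)
  fix P :: "real^'n^'n"
  assume "P \<in> orth_projectors CARD('k)"
  then have idem: "P ** P = P" and sym: "transpose P = P" and rank: "rank P = CARD('k)"
    by (auto simp: orth_projectors_def)
  have "subspace (range ((*v) P))"
    by (simp add: linear_subspace_image)
  then obtain B where B: "B \<subseteq> range ((*v) P)" "pairwise orthogonal B" "\<And>x. x \<in> B \<Longrightarrow> norm x = 1"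
      "independent B" "card B = dim (range ((*v) P))" "span B = range ((*v) P)"
    using orthonormal_basis_subspace by metis
  have "finite B" using B(4) by (rule independent_imp_finite)
  moreover have "card B = CARD('k)" using B(5) rank by (simp add: rank_dim_range)
  \<comment> \<open>The basis has as many elements as the type \<open>'k\<close>, so it can be
    indexed by \<open>'k\<close> and made the rows of a matrix.\<close>
  ultimately obtain b :: "'k \<Rightarrow> real^'n" where b: "bij_betw b UNIV B"
    using finite_same_card_bij[of "UNIV :: 'k set" B] by auto
  define V :: "real^'n^'k" where "V = (\<chi> j. b j)"
  have bB: "b j \<in> B" for j using b by (auto simp: bij_betw_def)
  have "b i \<bullet> b j = of_bool (i = j)" for i j
  proof (cases "i = j")
    case True
    then show ?thesis using B(3)[OF bB] by (simp add: norm_eq_1)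
  next
    case False
    then have "b i \<noteq> b j" using b by (auto simp: bij_betw_def inj_eq)
    then show ?thesis
      using False B(2) bB by (simp add: pairwise_def orthogonal_def)
  qed
  then have "V ** transpose V = mat 1"
    by (simp add: V_def vec_eq_iff matrix_matrix_mult_def transpose_def mat_def inner_vec_def)
  moreover have "P = transpose V ** V"
  proof -
    \<comment> \<open>\<open>P\<close> is the identity on its range. By symmetry of
      \<open>P\<close>, the coordinates of \<open>P *v x\<close> in the basis are therefore those of
      \<open>x\<close>, that is, the entries of \<open>V *v x\<close>.\<close>
    have Pb: "P *v b j = b j" for j
      using bB[of j] B(1) by (auto simp: matrix_vector_mul_assoc idem)
    have "P *v x = (transpose V ** V) *v x" for x
    proof -
      have dot: "(P *v x) \<bullet> b j = b j \<bullet> x" for j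
        by (metis Pb dot_lmul_matrix inner_commute sym transpose_matrix_vector)
      have Vx: "V *v x = (\<chi> j. b j \<bullet> x)"
        by (simp add: V_def matrix_mult_dot)
      have Vt: "transpose V *v y = (\<Sum>j\<in>UNIV. y $ j *\<^sub>R b j)" for y
        by (simp add: V_def vec_eq_iff matrix_vector_mult_def transpose_def mult.commute)
      have "P *v x = (\<Sum>v\<in>B. ((P *v x) \<bullet> v) *\<^sub>R v)"
        using orthonormal_basis_expand[OF B(2,3) _ \<open>finite B\<close>, of "P *v x"] B(6) by auto
      also have "\<dots> = (\<Sum>j\<in>UNIV. ((P *v x) \<bullet> b j) *\<^sub>R b j)"
        by (rule sum.reindex_bij_betw[OF b, symmetric])
      also have "\<dots> = transpose V *v (V *v x)"
        by (simp only: Vt Vx dot vec_lambda_beta)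
      finally show ?thesis by (simp add: matrix_vector_mul_assoc)
    qed
    then show ?thesis by (simp add: matrix_eq)
  qed
  ultimately show "P \<in> (\<lambda>V. transpose V ** V) ` {V :: real^'n^'k. V ** transpose V = mat 1}"
    by blast
next
  fix P :: "real^'n^'n"
  assume "P \<in> (\<lambda>V. transpose V ** V) ` {V :: real^'n^'k. V ** transpose V = mat 1}"
  then obtain V :: "real^'n^'k" where V: "V ** transpose V = mat 1" and P: "P = transpose V ** V"
    by blast
  \<comment> \<open>Compressing \<open>P\<close> by \<open>V\<close> gives the identity of size k,
    which forces \<open>rank P\<close> to be at least k.\<close>
  have "V ** (transpose V ** V) ** transpose V = (V ** transpose V) ** (V ** transpose V)"
    by (simp only: matrix_mul_assoc)
  then have VPV: "V ** P ** transpose V = mat 1" unfolding P V by (simp only: matrix_mul_lid)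
  have "CARD('k) = rank (V ** P ** transpose V)" by (simp add: VPV rank_I)
  also have "\<dots> \<le> rank (V ** P)" by (rule rank_mul_le_left)
  also have "\<dots> \<le> rank P" by (rule rank_mul_le_right)
  finally have "CARD('k) \<le> rank P" .
  moreover have "rank P \<le> rank V" unfolding P by (rule rank_mul_le_right)
  moreover have "rank V \<le> CARD('k)" using rank_bound[of V] by simp
  ultimately have "rank P = CARD('k)" by simp
  moreover have "P ** P = transpose V ** (V ** transpose V) ** V"
    by (simp only: P matrix_mul_assoc)
  then have "P ** P = P" by (simp add: V P)
  moreover have "transpose P = P" by (simp add: P matrix_transpose_mul)
  ultimately show "P \<in> orth_projectors CARD('k)" by (simp add: orth_projectors_def)
qed

lemma compact_orth_projectors: "compact (orth_projectors CARD('k::finite) :: (real^'n^'n) set)"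
  unfolding orth_projectors_eq_stiefel_image
  by (intro compact_continuous_image compact_stiefel continuous_intros)

section \<open>Existence of minima and their comparison\<close>

lemma compact_exists_arg_min:
  fixes f :: "'a::topological_space \<Rightarrow> real"
  assumes "compact S" and "S \<noteq> {}" and "continuous_on S f"
  shows "\<exists>x. is_arg_min f (\<lambda>x. x \<in> S) x"
  using continuous_attains_inf[OF assms] by (auto simp: is_arg_min_def not_less)

lemma continuous_on_proj_loss: "continuous_on S (proj_loss M)"
  unfolding proj_loss_def[abs_def] by (intro continuous_intros)

text \<open>The outer infima are attained, by the first two conjuncts. Full row rank can be lost in
  a limit, so compactness is not at hand for the fuzzy projectors, and the middle term is stated as
  an infimum.\<close>

theorem theorem3p6:
  fixes M :: "real^'n^'n" and m :: real
  assumes "sym_psd M"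
    and "m > 1"
    and "(hard_projectors TYPE('k::finite) :: (real^'n^'n) set) \<noteq> {}"
    and "(fuzzy_projectors TYPE('k) m :: (real^'n^'n) set) \<noteq> {}"
  shows "(\<exists>P. is_arg_min (proj_loss M) (\<lambda>P. P \<in> orth_projectors CARD('k)) P) \<and>
    (\<exists>P. is_arg_min (proj_loss M) (\<lambda>P. P \<in> hard_projectors TYPE('k)) P) \<and>
    (INF P \<in> orth_projectors CARD('k). proj_loss M P)
      \<le> (INF P \<in> fuzzy_projectors TYPE('k) m. proj_loss M P) \<and>
    (INF P \<in> fuzzy_projectors TYPE('k) m. proj_loss M P)
      \<le> (INF P \<in> hard_projectors TYPE('k). proj_loss M P)"
proof -
  \<comment> \<open>Monotonicity of a real \<open>INF\<close> under inclusion needs a lower bound on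
    the larger set and nonemptiness of the smaller one; a squared norm is bounded below by
    0.\<close>
  have bdd: "bdd_below (proj_loss M ` S)" for S
    by (rule bdd_belowI[of _ 0]) (auto simp: proj_loss_def)
  have fuzzy: "(fuzzy_projectors TYPE('k) m :: (real^'n^'n) set) \<subseteq> orth_projectors CARD('k)"
    by (rule fuzzy_projectors_subset_orth_projectors)
  have hard: "(hard_projectors TYPE('k) :: (real^'n^'n) set) \<subseteq> fuzzy_projectors TYPE('k) m"
    using assms(2) by (rule hard_projectors_subset_fuzzy_projectors)
  have orth_ne: "(orth_projectors CARD('k) :: (real^'n^'n) set) \<noteq> {}"
    using fuzzy assms(4) by blast
  show ?thesis
  proof (intro conjI)
    show "\<exists>P. is_arg_min (proj_loss M) (\<lambda>P. P \<in> orth_projectors CARD('k)) P"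
      by (rule compact_exists_arg_min[OF compact_orth_projectors orth_ne continuous_on_proj_loss])
    show "\<exists>P. is_arg_min (proj_loss M) (\<lambda>P. P \<in> hard_projectors TYPE('k)) P"
      by (rule compact_exists_arg_min[OF finite_imp_compact[OF finite_hard_projectors] assms(3)
            continuous_on_proj_loss])
    show "(INF P \<in> orth_projectors CARD('k). proj_loss M P)
        \<le> (INF P \<in> fuzzy_projectors TYPE('k) m. proj_loss M P)"
      by (rule cINF_superset_mono[OF assms(4) bdd fuzzy order_refl])
    show "(INF P \<in> fuzzy_projectors TYPE('k) m. proj_loss M P)
        \<le> (INF P \<in> hard_projectors TYPE('k). proj_loss M P)"
      by (rule cINF_superset_mono[OF assms(3) bdd hard order_refl])
  qed
qed

end
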